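(* Let $\mathbb{H}=\mathbb{R}^n$, $A=0$ and $B=I$ (the identity). Let $r$ be a nonzero real number with $r\notin\left\{1,\frac{1+\sqrt{13}}{2},\frac{1-\sqrt{13}}{2}\right\}$. Then there exist parameters $\lambda>0$ and $\delta\in\mathbb{R}$ such that, for every $x_0\in\mathbb{H}$, the generalized forward-reflected-backward iteration with $\alpha=0$ for this $A$ and $B$, that is $$x_{k+1}=(1-\lambda(\delta+2))x_k+\lambda(2\delta+1)x_{k-1}-\lambda\delta x_{k-2}\qquad (k\ge 2),$$ started from $x_0$, $x_1=\frac{x_0}{r}$, $x_2=\frac{x_0}{r^2}$, satisfies $x_k=\frac{x_0}{r^k}$ for all $k\ge 0$.
   Context: The generalized forward-reflected-backward (GFRB) iteration for $0\in(A+B)(x)$ with step-size $\lambda>0$ and parameters $\delta\in\mathbb{R}$, $\alpha\in[0,1)$ is $$x_{k+1}=J_{\lambda A}\big((1-\alpha)x_k+\alpha x_{k-1}-\lambda(\delta+2)B(x_k)+\lambda(2\delta+1)B(x_{k-1})-\lambda\delta B(x_{k-2})\big),$$ where $J_{\lambda A}=(I+\lambda A)^{-1}$; for $A=0$, $B=I$, $\alpha=0$ it reduces to the recursion displayed in the claim. *)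

theory Defs
  imports "HOL-Analysis.Analysis"
begin

text \<open>A set-valued operator on a space is a map \<open>A :: 'a \<Rightarrow> 'a set\<close>.\<close>

definition id_plus_scaled :: "real \<Rightarrow> ('a::real_vector \<Rightarrow> 'a set) \<Rightarrow> 'a \<Rightarrow> 'a set" where
  "id_plus_scaled lam A y = {y + lam *\<^sub>R a | a. a \<in> A y}"

definition inverse_op :: "('a \<Rightarrow> 'b set) \<Rightarrow> 'b \<Rightarrow> 'a set" where
  "inverse_op T u = {y. u \<in> T y}"

text \<open>The resolvent as a point-valued map. It is unspecified at points where the set-valued
  inverse of \<open>I + lam A\<close> is not a singleton (which does not happen for maximally monotone \<open>A\<close>
  and \<open>lam > 0\<close>).\<close>

definition resolvent :: "real \<Rightarrow> ('a::real_vector \<Rightarrow> 'a set) \<Rightarrow> 'a \<Rightarrow> 'a" where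
  "resolvent lam A u = (THE y. y \<in> inverse_op (id_plus_scaled lam A) u)"

definition zero_op :: "'a::real_vector \<Rightarrow> 'a set" where
  "zero_op y = {0}"

text \<open>One iteration step: the next iterate from the current one \<open>x\<close>, the previous one \<open>y\<close>
  and the one before that \<open>z\<close>.\<close>

definition gfrb_step :: "('a::real_vector \<Rightarrow> 'a set) \<Rightarrow> ('a \<Rightarrow> 'a) \<Rightarrow> real \<Rightarrow> real \<Rightarrow> real
    \<Rightarrow> 'a \<Rightarrow> 'a \<Rightarrow> 'a \<Rightarrow> 'a" where
  "gfrb_step A B lam \<delta> \<alpha> x y z =
    resolvent lam A
      ((1 - \<alpha>) *\<^sub>R x + \<alpha> *\<^sub>R y - (lam * (\<delta> + 2)) *\<^sub>R B x
       + (lam * (2 * \<delta> + 1)) *\<^sub>R B y - (lam * \<delta>) *\<^sub>R B z)"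

text \<open>The sequence started from the three points \<open>x0\<close>, \<open>x1\<close>, \<open>x2\<close>.\<close>

fun gfrb :: "('a::real_vector \<Rightarrow> 'a set) \<Rightarrow> ('a \<Rightarrow> 'a) \<Rightarrow> real \<Rightarrow> real \<Rightarrow> real
    \<Rightarrow> 'a \<Rightarrow> 'a \<Rightarrow> 'a \<Rightarrow> nat \<Rightarrow> 'a" where
  "gfrb A B lam \<delta> \<alpha> x0 x1 x2 0 = x0"
| "gfrb A B lam \<delta> \<alpha> x0 x1 x2 (Suc 0) = x1"
| "gfrb A B lam \<delta> \<alpha> x0 x1 x2 (Suc (Suc 0)) = x2"
| "gfrb A B lam \<delta> \<alpha> x0 x1 x2 (Suc (Suc (Suc k))) =
    gfrb_step A B lam \<delta> \<alpha>
      (gfrb A B lam \<delta> \<alpha> x0 x1 x2 (Suc (Suc k)))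
      (gfrb A B lam \<delta> \<alpha> x0 x1 x2 (Suc k))
      (gfrb A B lam \<delta> \<alpha> x0 x1 x2 k)"

end

theory Submission
  imports Defs
begin

text \<open>
  For \<open>A = 0\<close> the resolvent is the identity, so the iteration is a third-order linear recursion, and
  the geometric sequence of ratio \<open>1 / r\<close> solves it if
  \<open>1 = (1 - lam (\<delta> + 2)) r + lam (2 \<delta> + 1) r\<^sup>2 - lam \<delta> r\<^sup>3\<close>.
  The coefficient of \<open>\<delta>\<close> in this equation is \<open>- lam r (r - 1)\<^sup>2\<close>, so for any \<open>lam\<close> it can
  be solved for \<open>\<delta>\<close> unless \<open>r\<close> is \<open>0\<close> or \<open>1\<close>.
\<close>

lemma resolvent_zero_op [simp]: "resolvent lam zero_op u = u"
  by (simp add: resolvent_def inverse_op_def id_plus_scaled_def zero_op_def)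

lemma gfrb_step_zero_op_id:
  "gfrb_step zero_op id lam \<delta> 0 x y z =
    (1 - lam * (\<delta> + 2)) *\<^sub>R x + (lam * (2 * \<delta> + 1)) *\<^sub>R y - (lam * \<delta>) *\<^sub>R z"
  by (simp add: gfrb_step_def scaleR_diff_left)

text \<open>The assumption \<open>char\<close> is the characteristic equation of the recursion at
  the root \<open>1 / r\<close>, multiplied by \<open>r ^ 3\<close>.\<close>

lemma gfrb_zero_op_id_geometric:
  fixes r lam \<delta> :: real and x0 :: "'a::real_vector"
  assumes r: "r \<noteq> 0"
    and char: "1 = (1 - lam * (\<delta> + 2)) * r + lam * (2 * \<delta> + 1) * r ^ 2 - lam * \<delta> * r ^ 3"
  shows "gfrb zero_op id lam \<delta> 0 x0 (x0 /\<^sub>R r) (x0 /\<^sub>R r ^ 2) k = x0 /\<^sub>R r ^ k"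
proof -
  let ?x = "gfrb zero_op id lam \<delta> 0 x0 (x0 /\<^sub>R r) (x0 /\<^sub>R r ^ 2)"
  \<comment> \<open>The recursion has order three, so the induction carries three consecutive
    terms.\<close>
  have "?x k = x0 /\<^sub>R r ^ k \<and> ?x (Suc k) = x0 /\<^sub>R r ^ Suc k
    \<and> ?x (Suc (Suc k)) = x0 /\<^sub>R r ^ Suc (Suc k)"
  proof (induction k)
    case 0
    show ?case by (simp add: power2_eq_square)
  next
    case (Suc k)
    let ?c = "(1 - lam * (\<delta> + 2)) * r + lam * (2 * \<delta> + 1) * r ^ 2 - lam * \<delta> * r ^ 3"
    have "?x (Suc (Suc (Suc k))) = (1 - lam * (\<delta> + 2)) *\<^sub>R (x0 /\<^sub>R r ^ Suc (Suc k))
        + (lam * (2 * \<delta> + 1)) *\<^sub>R (x0 /\<^sub>R r ^ Suc k) - (lam * \<delta>) *\<^sub>R (x0 /\<^sub>R r ^ k)"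
      using Suc.IH by (simp only: gfrb.simps gfrb_step_zero_op_id)
    also have "\<dots> = ((1 - lam * (\<delta> + 2)) * inverse (r ^ Suc (Suc k))
        + lam * (2 * \<delta> + 1) * inverse (r ^ Suc k) - lam * \<delta> * inverse (r ^ k)) *\<^sub>R x0"
      by (simp only: scaleR_scaleR scaleR_add_left scaleR_diff_left)
    \<comment> \<open>Over the common denominator \<open>r ^ (k + 3)\<close> the numerator is the
      right-hand side of \<open>char\<close>, hence 1.\<close>
    also have "\<dots> = (?c / r ^ Suc (Suc (Suc k))) *\<^sub>R x0"
    proof -
      have "inverse (r ^ Suc (Suc k)) = r / r ^ Suc (Suc (Suc k))"
        "inverse (r ^ Suc k) = r ^ 2 / r ^ Suc (Suc (Suc k))"
        "inverse (r ^ k) = r ^ 3 / r ^ Suc (Suc (Suc k))"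
        using r by (simp_all add: divide_simps power2_eq_square power3_eq_cube)
      then show ?thesis by (simp only: add_divide_distrib diff_divide_distrib times_divide_eq_right)
    qed
    also have "\<dots> = x0 /\<^sub>R r ^ Suc (Suc (Suc k))"
      by (simp only: char[symmetric] inverse_eq_divide)
    finally show ?case using Suc.IH by blast
  qed
  then show ?thesis by blast
qed

theorem lemma4p2:
  fixes r :: real
  assumes "r \<noteq> 0"
    and "r \<notin> {1, (1 + sqrt 13) / 2, (1 - sqrt 13) / 2}"
  shows "\<exists>lam>0. \<exists>\<delta>::real. \<forall>x0 :: real ^ 'n.
    (let x = gfrb zero_op id lam \<delta> 0 x0 (x0 /\<^sub>R r) (x0 /\<^sub>R r ^ 2) in
      (\<forall>k\<ge>2. x (k + 1) = (1 - lam * (\<delta> + 2)) *\<^sub>R x k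
          + (lam * (2 * \<delta> + 1)) *\<^sub>R x (k - 1) - (lam * \<delta>) *\<^sub>R x (k - 2)) \<and>
      (\<forall>k. x k = x0 /\<^sub>R r ^ k))"
proof -
  \<comment> \<open>This solves the characteristic equation for \<open>\<delta>\<close> at
    \<open>lam = 1\<close>; the denominator is nonzero as \<open>r\<close> is neither 0 nor
    1.\<close>
  define \<delta> where "\<delta> = (r ^ 2 - r - 1) / (r * (r - 1) ^ 2)"
  have "\<delta> * (r * (r - 1) ^ 2) = r ^ 2 - r - 1"
    using assms by (simp add: \<delta>_def)
  \<comment> \<open>The factors \<open>1 *\<close> keep the form of the lemma's assumption at
    \<open>lam = 1\<close>.\<close>
  then have char: "1 = (1 - 1 * (\<delta> + 2)) * r + 1 * (2 * \<delta> + 1) * r ^ 2 - 1 * \<delta> * r ^ 3"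
    by (simp add: algebra_simps power2_eq_square power3_eq_cube)
  have rec: "gfrb zero_op id 1 \<delta> 0 x0 x1 x2 (k + 1)
      = (1 - 1 * (\<delta> + 2)) *\<^sub>R gfrb zero_op id 1 \<delta> 0 x0 x1 x2 k
        + (1 * (2 * \<delta> + 1)) *\<^sub>R gfrb zero_op id 1 \<delta> 0 x0 x1 x2 (k - 1)
        - (1 * \<delta>) *\<^sub>R gfrb zero_op id 1 \<delta> 0 x0 x1 x2 (k - 2)"
    if "k \<ge> 2" for k and x0 x1 x2 :: "real ^ 'n"
  proof -
    \<comment> \<open>Since \<open>k \<ge> 2\<close>, the subtractions on naturals are exact and the
      last \<open>gfrb\<close> equation applies.\<close>
    have "k = Suc (Suc (k - 2))"
      using that by simp
    then obtain j where "k = Suc (Suc j)" ..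
    then show ?thesis
      by (simp add: gfrb_step_zero_op_id)
  qed
  show ?thesis
    unfolding Let_def
    by (intro exI[of _ 1] conjI exI[of _ \<delta>] allI impI zero_less_one)
      (erule rec, rule gfrb_zero_op_id_geometric[OF assms(1) char])
qed

end
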